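(* The linear operator $$\mathrm{T}:=\operatorname{tr}\oplus\operatorname{tr}:\mathcal{H}_+^2\to\mathfrak{H}^4,\qquad \mathrm{T}\mathbf{u}=(\Gamma_0u_1,\Gamma_1u_1,\Gamma_0u_2,\Gamma_1u_2)^\top,\quad \mathbf{u}=(u_1,u_2)^\top\in\mathcal{H}_+^2,$$ is bounded and surjective, and satisfies $$\ker(\mathrm{T})=\operatorname{dom}(N)=\operatorname{dom}(A)\times\operatorname{dom}(A).$$ Moreover, for all $\mathbf{u},\mathbf{v}\in\operatorname{dom}((\tau N)^* )=\mathcal{H}_+^2$, $$\langle(\tau N)^*\mathbf{u},\mathbf{v}\rangle_{\mathcal{H}^2}-\langle\mathbf{u},(\tau N)^*\mathbf{v}\rangle_{\mathcal{H}^2}=\Omega(\mathrm{T}\mathbf{u},\mathrm{T}\mathbf{v}),$$ and, for every $\lambda\in\mathbb{R}$ and all $\mathbf{u},\mathbf{v}\in\mathcal{H}_+^2$, $$\langle(N^*-\lambda)\tau\mathbf{u},\mathbf{v}\rangle_{\mathcal{H}^2}-\langle\mathbf{u},(N^*-\lambda)\tau\mathbf{v}\rangle_{\mathcal{H}^2}=\Omega(\mathrm{T}\mathbf{u},\mathrm{T}\mathbf{v}).$$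
   Context: $\mathcal{H},\mathfrak{H}$ are separable complex Hilbert spaces. $A$ is a closed, densely defined, symmetric linear operator in $\mathcal{H}$ with $\dim\ker(A^*+i)=\dim\ker(A^*-i)<\infty$. $\mathcal{H}_+:=\operatorname{dom}(A^* )$ is equipped with the graph scalar product $\langle u,v\rangle_{\mathcal{H}_+}=\langle u,v\rangle_{\mathcal{H}}+\langle A^*u,A^*v\rangle_{\mathcal{H}}$. The trace operator $\operatorname{tr}=(\Gamma_0,\Gamma_1)^\top:\mathcal{H}_+\to\mathfrak{H}\times\mathfrak{H}$ is a bounded and surjective linear operator satisfying, for all $u,v\in\operatorname{dom}(A^* )$, $$\langle A^*u,v\rangle_{\mathcal{H}}-\langle u,A^*v\rangle_{\mathcal{H}}=\langle\Gamma_1u,\Gamma_0v\rangle_{\mathfrak{H}}-\langle\Gamma_0u,\Gamma_1v\rangle_{\mathfrak{H}}.$$ Put $\mathcal{H}^2=\mathcal{H}\times\mathcal{H}$, $\mathcal{H}_+^2=\mathcal{H}_+\times\mathcal{H}_+$, $\mathfrak{H}^4=(\mathfrak{H}\times\mathfrak{H})\times(\mathfrak{H}\times\mathfrak{H})$. In $\mathcal{H}^2$ define $$N=\begin{pmatrix}0&-A\\ A&0\end{pmatrix},\ \operatorname{dom}(N)=\operatorname{dom}(A)\times\operatorname{dom}(A),\qquad N^*=\begin{pmatrix}0&A^*\\ -A^*&0\end{pmatrix},\ \operatorname{dom}(N^* )=\mathcal{H}_+^2,\qquad \tau=\begin{pmatrix}0&I\\ I&0\end{pmatrix},$$ so that $\tau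 N=A\oplus(-A)$. The symplectic form on $\mathfrak{H}^4$ is $$\Omega\big((f_1,f_2,f_3,f_4)^\top,(g_1,g_2,g_3,g_4)^\top\big)=\langle f_2,g_1\rangle_{\mathfrak{H}}-\langle f_1,g_2\rangle_{\mathfrak{H}}-\langle f_4,g_3\rangle_{\mathfrak{H}}+\langle f_3,g_4\rangle_{\mathfrak{H}}.$$ *)

theory Defs
  imports "HOL-Analysis.Analysis"
begin

section \<open>Complex Hilbert spaces\<close>

text \<open>The scalar product is linear in the first argument and antilinear in the second one.\<close>

class complex_inner = real_normed_vector +
  fixes scaleC :: "complex \<Rightarrow> 'a \<Rightarrow> 'a"  (infixr \<open>*\<^sub>C\<close> 75)
    and cinner :: "'a \<Rightarrow> 'a \<Rightarrow> complex"
  assumes scaleC_add_right: "c *\<^sub>C (x + y) = c *\<^sub>C x + c *\<^sub>C y"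
    and scaleC_add_left: "(c + d) *\<^sub>C x = c *\<^sub>C x + d *\<^sub>C x"
    and scaleC_scaleC: "c *\<^sub>C d *\<^sub>C x = (c * d) *\<^sub>C x"
    and scaleC_one: "1 *\<^sub>C x = x"
    and scaleR_scaleC: "r *\<^sub>R x = complex_of_real r *\<^sub>C x"
    and cinner_commute: "cinner x y = cnj (cinner y x)"
    and cinner_add_left: "cinner (x + y) z = cinner x z + cinner y z"
    and cinner_scaleC_left: "cinner (c *\<^sub>C x) y = c * cinner x y"
    and norm_eq_sqrt_cinner: "norm x = sqrt (Re (cinner x x))"

class chilbert_space = complex_inner + complete_space

global_interpretation complex_vector: vector_space "scaleC :: complex \<Rightarrow> 'a \<Rightarrow> 'a::complex_inner"
  by unfold_locales (simp_all add: scaleC_add_right scaleC_add_left scaleC_scaleC scaleC_one)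

text \<open>The product norm of \<open>HOL-Analysis\<close> is the Euclidean one, so products of complex Hilbert
  spaces carry the usual scalar product of the orthogonal sum.\<close>

lemma cinner_self: "cinner x x = complex_of_real ((norm x)\<^sup>2)"
proof -
  have "sqrt (Re (cinner x x)) \<ge> 0"
    by (metis norm_eq_sqrt_cinner norm_ge_zero)
  then have "(norm x)\<^sup>2 = Re (cinner x x)"
    by (simp add: norm_eq_sqrt_cinner)
  moreover have "Im (cinner x x) = 0"
    by (metis cinner_commute complex_cnj_cancel_iff Reals_cnj_iff complex_is_Real_iff)
  ultimately show ?thesis
    by (simp add: complex_eq_iff)
qed

instantiation complex :: chilbert_space
begin

definition scaleC_complex :: "complex \<Rightarrow> complex \<Rightarrow> complex" where
  "scaleC_complex c x = c * x"

definition cinner_complex :: "complex \<Rightarrow> complex \<Rightarrow> complex" where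
  "cinner_complex x y = x * cnj y"

instance
  by standard
    (simp_all add: scaleC_complex_def cinner_complex_def algebra_simps scaleR_conv_of_real
      norm_complex_def power2_eq_square)

end

instantiation prod :: (complex_inner, complex_inner) complex_inner
begin

definition scaleC_prod :: "complex \<Rightarrow> 'a \<times> 'b \<Rightarrow> 'a \<times> 'b" where
  "scaleC_prod c x = (c *\<^sub>C fst x, c *\<^sub>C snd x)"

definition cinner_prod :: "'a \<times> 'b \<Rightarrow> 'a \<times> 'b \<Rightarrow> complex" where
  "cinner_prod x y = cinner (fst x) (fst y) + cinner (snd x) (snd y)"

instance
proof
  fix x y z :: "'a \<times> 'b" and c d :: complex and r :: real
  show "c *\<^sub>C (x + y) = c *\<^sub>C x + c *\<^sub>C y" "(c + d) *\<^sub>C x = c *\<^sub>C x + d *\<^sub>C x"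
    "c *\<^sub>C d *\<^sub>C x = (c * d) *\<^sub>C x" "1 *\<^sub>C x = x"
    by (simp_all add: scaleC_prod_def scaleC_add_right scaleC_add_left scaleC_scaleC scaleC_one)
  show "r *\<^sub>R x = complex_of_real r *\<^sub>C x"
    by (simp add: scaleC_prod_def scaleR_prod_def scaleR_scaleC)
  show "cinner x y = cnj (cinner y x)"
    unfolding cinner_prod_def complex_cnj_add by (metis cinner_commute)
  show "cinner (x + y) z = cinner x z + cinner y z"
    by (simp add: cinner_prod_def cinner_add_left)
  show "cinner (c *\<^sub>C x) y = c * cinner x y"
    by (simp add: cinner_prod_def scaleC_prod_def cinner_scaleC_left algebra_simps)
  show "norm x = sqrt (Re (cinner x x))"
    by (simp add: cinner_prod_def norm_prod_def cinner_self)
qed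

end

instance prod :: (chilbert_space, chilbert_space) chilbert_space ..

definition finite_cdim :: "'a::complex_inner set \<Rightarrow> bool" where
  "finite_cdim S \<longleftrightarrow> (\<exists>B. finite B \<and> S \<subseteq> complex_vector.span B)"

definition clinear_on :: "'a::complex_inner set \<Rightarrow> ('a \<Rightarrow> 'b::complex_inner) \<Rightarrow> bool" where
  "clinear_on S f \<longleftrightarrow> (\<forall>x\<in>S. \<forall>y\<in>S. f (x + y) = f x + f y) \<and> (\<forall>c. \<forall>x\<in>S. f (c *\<^sub>C x) = c *\<^sub>C f x)"

text \<open>Boundedness of \<open>f\<close> on the inner product space \<open>S\<close> whose scalar product is \<open>ip\<close>; this need
  not be the scalar product that \<open>S\<close> inherits from the surrounding type.\<close>

definition bounded_wrt ::
  "('a \<Rightarrow> 'a \<Rightarrow> complex) \<Rightarrow> 'a set \<Rightarrow> ('a \<Rightarrow> 'b::real_normed_vector) \<Rightarrow> bool" where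
  "bounded_wrt ip S f \<longleftrightarrow> (\<exists>C. \<forall>x\<in>S. norm (f x) \<le> C * sqrt (Re (ip x x)))"

section \<open>Unbounded operators\<close>

text \<open>An operator between spaces \<open>'a\<close> and \<open>'b\<close> is a partial function \<open>B :: 'a \<rightharpoonup> 'b\<close> with domain
  \<open>dom B\<close>; hence equality of operators includes equality of their domains.\<close>

definition op_app :: "('a \<rightharpoonup> 'b) \<Rightarrow> 'a \<Rightarrow> 'b"  (infixr \<open>\<cdot>\<close> 90) where
  "B \<cdot> u = the (B u)"

definition linear_op :: "('a::complex_inner \<rightharpoonup> 'b::complex_inner) \<Rightarrow> bool" where
  "linear_op B \<longleftrightarrow> complex_vector.subspace (dom B) \<and> clinear_on (dom B) (op_app B)"

definition closed_op :: "('a::complex_inner \<rightharpoonup> 'b::complex_inner) \<Rightarrow> bool" where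
  "closed_op B \<longleftrightarrow> closed (Map.graph B)"

definition densely_defined :: "('a::complex_inner \<rightharpoonup> 'b) \<Rightarrow> bool" where
  "densely_defined B \<longleftrightarrow> closure (dom B) = UNIV"

definition symmetric_op :: "('a::complex_inner \<rightharpoonup> 'a) \<Rightarrow> bool" where
  "symmetric_op B \<longleftrightarrow> (\<forall>u\<in>dom B. \<forall>v\<in>dom B. cinner (B \<cdot> u) v = cinner u (B \<cdot> v))"

text \<open>\<open>op_adjoint B\<close> is meaningful for densely defined \<open>B\<close>, see \<open>op_adjoint_eq_Some\<close> below.\<close>

definition op_adjoint :: "('a::complex_inner \<rightharpoonup> 'b::complex_inner) \<Rightarrow> ('b \<rightharpoonup> 'a)" where
  "op_adjoint B v =
    (if \<exists>w. \<forall>u\<in>dom B. cinner (B \<cdot> u) v = cinner u w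
     then Some (THE w. \<forall>u\<in>dom B. cinner (B \<cdot> u) v = cinner u w) else None)"

definition op_shift :: "('a::complex_inner \<rightharpoonup> 'a) \<Rightarrow> complex \<Rightarrow> ('a \<rightharpoonup> 'a)" where
  "op_shift B z = (\<lambda>u. map_option (\<lambda>w. w + z *\<^sub>C u) (B u))"

definition op_ker :: "('a \<rightharpoonup> 'b::zero) \<Rightarrow> 'a set" where
  "op_ker B = {u. B u = Some 0}"

section \<open>Graph space, trace operators and the doubled operator\<close>

definition Hplus :: "('h::complex_inner \<rightharpoonup> 'h) \<Rightarrow> 'h set" where
  "Hplus A = dom (op_adjoint A)"

definition Hplus_inner :: "('h::complex_inner \<rightharpoonup> 'h) \<Rightarrow> 'h \<Rightarrow> 'h \<Rightarrow> complex" where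
  "Hplus_inner A u v = cinner u v + cinner (op_adjoint A \<cdot> u) (op_adjoint A \<cdot> v)"

definition Hplus2 :: "('h::complex_inner \<rightharpoonup> 'h) \<Rightarrow> ('h \<times> 'h) set" where
  "Hplus2 A = Hplus A \<times> Hplus A"

definition Hplus2_inner :: "('h::complex_inner \<rightharpoonup> 'h) \<Rightarrow> 'h \<times> 'h \<Rightarrow> 'h \<times> 'h \<Rightarrow> complex" where
  "Hplus2_inner A u v = Hplus_inner A (fst u) (fst v) + Hplus_inner A (snd u) (snd v)"

definition tr :: "('h \<Rightarrow> 'k) \<Rightarrow> ('h \<Rightarrow> 'k) \<Rightarrow> 'h \<Rightarrow> 'k \<times> 'k" where
  "tr \<Gamma>0 \<Gamma>1 u = (\<Gamma>0 u, \<Gamma>1 u)"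

definition Tr :: "('h \<Rightarrow> 'k) \<Rightarrow> ('h \<Rightarrow> 'k) \<Rightarrow> 'h \<times> 'h \<Rightarrow> ('k \<times> 'k) \<times> ('k \<times> 'k)" where
  "Tr \<Gamma>0 \<Gamma>1 = map_prod (tr \<Gamma>0 \<Gamma>1) (tr \<Gamma>0 \<Gamma>1)"

lemma Tr_apply: "Tr \<Gamma>0 \<Gamma>1 (u1, u2) = ((\<Gamma>0 u1, \<Gamma>1 u1), (\<Gamma>0 u2, \<Gamma>1 u2))"
  by (simp add: Tr_def tr_def)

fun \<Omega> :: "('k::complex_inner \<times> 'k) \<times> ('k \<times> 'k) \<Rightarrow> ('k \<times> 'k) \<times> ('k \<times> 'k) \<Rightarrow> complex" where
  "\<Omega> ((f1, f2), (f3, f4)) ((g1, g2), (g3, g4)) =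
    cinner f2 g1 - cinner f1 g2 - cinner f4 g3 + cinner f3 g4"

definition N_op :: "('h::complex_inner \<rightharpoonup> 'h) \<Rightarrow> ('h \<times> 'h \<rightharpoonup> 'h \<times> 'h)" where
  "N_op A = (\<lambda>(u1, u2). if u1 \<in> dom A \<and> u2 \<in> dom A then Some (- (A \<cdot> u2), A \<cdot> u1) else None)"

definition \<tau> :: "'h \<times> 'h \<rightharpoonup> 'h \<times> 'h" where
  "\<tau> = (\<lambda>(u1, u2). Some (u2, u1))"

text \<open>Composition of operators is \<open>\<circ>\<^sub>m\<close>, whose domain is the usual maximal one.\<close>

lemma tau_N_op:
  "(\<tau> \<circ>\<^sub>m N_op A) (u1, u2) =
    (if u1 \<in> dom A \<and> u2 \<in> dom A then Some (A \<cdot> u1, - (A \<cdot> u2)) else None)"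
  by (simp add: map_comp_def N_op_def \<tau>_def)

subsection \<open>The adjoint of a densely defined operator\<close>

lemma cinner_zero_left [simp]: "cinner 0 x = 0"
  using cinner_add_left[of 0 0 x] by simp

lemma cinner_zero_right [simp]: "cinner x 0 = 0"
  by (subst cinner_commute) simp

lemma cinner_minus_left: "cinner (- x) y = - cinner x y"
  using cinner_add_left[of x "- x" y] by (simp add: eq_neg_iff_add_eq_0 add.commute)

lemma cinner_add_right: "cinner x (y + z) = cinner x y + cinner x z"
  by (metis cinner_commute cinner_add_left complex_cnj_add)

lemma cinner_minus_right: "cinner x (- y) = - cinner x y"
  by (metis cinner_commute cinner_minus_left complex_cnj_minus)

lemma orthogonal_dense_eq_0:
  assumes "closure S = UNIV" and orth: "\<And>u. u \<in> S \<Longrightarrow> cinner u w = 0"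
  shows "w = 0"
proof (rule ccontr)
  assume "w \<noteq> 0"
  then have "norm w > 0"
    by simp
  moreover have "w \<in> closure S"
    using assms(1) by simp
  ultimately obtain u where u: "u \<in> S" "dist u w < norm w"
    by (meson closure_approachable)
  have "cinner u w = 0" "cinner w u = 0"
    using orth[OF u(1)] by (simp, metis cinner_commute complex_cnj_zero)
  then have "cinner (u + - w) (u + - w) = cinner u u + cinner w w"
    by (simp add: cinner_add_left cinner_add_right cinner_minus_left cinner_minus_right
        del: add_uminus_conv_diff)
  then have "complex_of_real ((norm (u - w))\<^sup>2) = complex_of_real ((norm u)\<^sup>2 + (norm w)\<^sup>2)"
    by (simp add: cinner_self)
  then have "(norm (u - w))\<^sup>2 = (norm u)\<^sup>2 + (norm w)\<^sup>2"
    by (metis of_real_eq_iff)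
  then have "(norm w)\<^sup>2 \<le> (norm (u - w))\<^sup>2"
    by simp
  then have "norm w \<le> norm (u - w)"
    by (simp add: power2_le_iff_abs_le)
  with u(2) show False
    by (simp add: dist_norm)
qed

lemma op_adjoint_eq_Some:
  assumes "densely_defined B"
  shows "op_adjoint B v = Some w \<longleftrightarrow> (\<forall>u\<in>dom B. cinner (B \<cdot> u) v = cinner u w)"
proof -
  have uniq: "w1 = w2" if "\<forall>u\<in>dom B. cinner (B \<cdot> u) v = cinner u w1"
    "\<forall>u\<in>dom B. cinner (B \<cdot> u) v = cinner u w2" for w1 w2
  proof -
    have "w1 + - w2 = 0"
      using assms that unfolding densely_defined_def
      by (intro orthogonal_dense_eq_0[of "dom B"])
        (auto simp: cinner_add_right cinner_minus_right simp del: add_uminus_conv_diff)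
    then show ?thesis
      by simp
  qed
  have the: "(THE w. \<forall>u\<in>dom B. cinner (B \<cdot> u) v = cinner u w) = w'"
    if "\<forall>u\<in>dom B. cinner (B \<cdot> u) v = cinner u w'" for w'
    using that uniq by (intro the_equality) blast+
  show ?thesis
  proof
    assume "op_adjoint B v = Some w"
    moreover from this obtain w' where w': "\<forall>u\<in>dom B. cinner (B \<cdot> u) v = cinner u w'"
      unfolding op_adjoint_def by (meson option.distinct(1))
    ultimately have "w = w'"
      unfolding op_adjoint_def the[OF w'] by (auto split: if_splits)
    with w' show "\<forall>u\<in>dom B. cinner (B \<cdot> u) v = cinner u w"
      by simp
  next
    assume w: "\<forall>u\<in>dom B. cinner (B \<cdot> u) v = cinner u w"
    then show "op_adjoint B v = Some w"
      unfolding op_adjoint_def the[OF w] by (subst if_P) blast+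
  qed
qed

lemma op_adjoint_N_op:
  assumes "linear_op A" and dense: "densely_defined A"
  shows "op_adjoint (N_op A) = (\<lambda>(v1, v2).
    if v1 \<in> dom (op_adjoint A) \<and> v2 \<in> dom (op_adjoint A)
    then Some (op_adjoint A \<cdot> v2, - (op_adjoint A \<cdot> v1)) else None)"
proof -
  have dom_N: "dom (N_op A) = dom A \<times> dom A"
    by (auto simp: N_op_def split: if_splits)
  have app_N: "N_op A \<cdot> (u1, u2) = (- (A \<cdot> u2), A \<cdot> u1)" if "u1 \<in> dom A" "u2 \<in> dom A" for u1 u2
    using that by (simp add: N_op_def op_app_def domIff)
  have dense_N: "densely_defined (N_op A)"
    using dense by (simp add: densely_defined_def dom_N closure_Times)
  have z: "0 \<in> dom A" and A0: "A \<cdot> 0 = 0"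
  proof -
    show z: "0 \<in> dom A"
      using assms(1) by (auto simp: linear_op_def complex_vector.subspace_def)
    have "A \<cdot> (0 + 0) = A \<cdot> 0 + A \<cdot> 0"
      using assms(1) z unfolding linear_op_def clinear_on_def by blast
    then show "A \<cdot> 0 = 0"
      by simp
  qed
  have key: "op_adjoint (N_op A) (v1, v2) = Some (w1, w2) \<longleftrightarrow>
      op_adjoint A v2 = Some w1 \<and> op_adjoint A v1 = Some (- w2)" for v1 v2 w1 w2
  proof -
    have "op_adjoint (N_op A) (v1, v2) = Some (w1, w2) \<longleftrightarrow>
      (\<forall>u1\<in>dom A. \<forall>u2\<in>dom A.
        - cinner (A \<cdot> u2) v1 + cinner (A \<cdot> u1) v2 = cinner u1 w1 + cinner u2 w2)"
      by (auto simp: op_adjoint_eq_Some[OF dense_N] dom_N app_N cinner_prod_def cinner_minus_left)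
    also have "\<dots> \<longleftrightarrow> (\<forall>u\<in>dom A. cinner (A \<cdot> u) v2 = cinner u w1) \<and>
        (\<forall>u\<in>dom A. cinner (A \<cdot> u) v1 = cinner u (- w2))" (is "?L \<longleftrightarrow> ?R")
    proof
      assume L: ?L
      show ?R
      proof (intro conjI ballI)
        fix u assume u: "u \<in> dom A"
        show "cinner (A \<cdot> u) v2 = cinner u w1"
          using L[rule_format, OF u z] by (simp add: A0)
        show "cinner (A \<cdot> u) v1 = cinner u (- w2)"
          using L[rule_format, OF z u] by (simp add: A0 cinner_minus_right minus_equation_iff)
      qed
    next
      assume ?R
      then show ?L
        by (simp add: cinner_minus_right)
    qed
    finally show ?thesis
      by (simp add: op_adjoint_eq_Some[OF dense])
  qed
  have "op_adjoint (N_op A) (v1, v2) =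
    (if v1 \<in> dom (op_adjoint A) \<and> v2 \<in> dom (op_adjoint A)
    then Some (op_adjoint A \<cdot> v2, - (op_adjoint A \<cdot> v1)) else None)" for v1 v2
  proof (cases "v1 \<in> dom (op_adjoint A) \<and> v2 \<in> dom (op_adjoint A)")
    case True
    then show ?thesis
      by (auto simp: key op_app_def)
  next
    case False
    then have "op_adjoint (N_op A) (v1, v2) \<noteq> Some w" for w
      using key[of v1 v2 "fst w" "snd w"] by auto
    then show ?thesis
      using False by (metis not_Some_eq)
  qed
  then show ?thesis
    by auto
qed

lemma dom_shift_adjoint_tau:
  assumes "linear_op A" and "densely_defined A"
  shows "dom (op_shift (op_adjoint (N_op A)) z \<circ>\<^sub>m \<tau>) = Hplus2 A"
  by (auto simp: op_adjoint_N_op[OF assms] op_shift_def map_comp_def \<tau>_def Hplus2_def Hplus_def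
      split: if_splits)

end

theory Submission
  imports Defs
begin

text \<open>The doubled operator inherits everything from a single copy of \<open>A\<close>, except for two points.

  The kernel of the trace operator is \<open>dom A\<close>. An element \<open>u\<close> of \<open>dom A\<close> also lies in
  \<open>dom A\<^sup>*\<close>, with \<open>A\<^sup>* u = A u\<close>, so the left-hand side of Green's identity vanishes for every
  \<open>v \<in> dom A\<^sup>*\<close>. As the trace operator is onto, \<open>v\<close> may be chosen with traces
  \<open>(\<Gamma>\<^sub>1 u, - \<Gamma>\<^sub>0 u)\<close>, and the right-hand side becomes the squared norm of the traces of \<open>u\<close>
  (\<open>trace_eq_0_if_dom\<close>). Conversely, vanishing traces of \<open>u\<close> make the right-hand side vanish for
  every \<open>v\<close>, which says that \<open>u\<close> is in the domain of \<open>A\<^sup>*\<^sup>*\<close>. Since \<open>A\<close> is closed,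
  \<open>A\<^sup>*\<^sup>* = A\<close>. This is the only analytic ingredient (\<open>closed_op_biadjoint\<close>): the vectors orthogonal
  to the graph of \<open>A\<close> are the rotated graph of \<open>A\<^sup>*\<close>, and a closed subspace of a Hilbert space is
  its own double orthogonal complement.

  The second point is that the flip \<open>\<tau>\<close> is self-adjoint and everywhere defined, whence
  \<open>(\<tau> N)\<^sup>* = N\<^sup>* \<tau>\<close>. The first Green identity is thereby the case \<open>\<lambda> = 0\<close> of the second one. In the
  latter the terms with \<open>\<lambda>\<close> cancel, because \<open>\<lambda>\<close> is real and \<open>\<tau>\<close> self-adjoint, and what is left is
  the difference of the Green identities for the two components.\<close>

section \<open>The projection theorem\<close>

lemma cinner_scaleC_right: "cinner x (c *\<^sub>C y) = cnj c * cinner x y"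
  by (metis cinner_commute cinner_scaleC_left complex_cnj_mult)

lemma cinner_diff_left: "cinner (x - y) z = cinner x z - cinner y z"
  by (metis cinner_add_left cinner_minus_left diff_conv_add_uminus)

lemma cinner_diff_right: "cinner x (y - z) = cinner x y - cinner x z"
  by (metis cinner_add_right cinner_minus_right diff_conv_add_uminus)

lemma power2_norm_eq_Re_cinner: "(norm x)\<^sup>2 = Re (cinner x x)"
  by (simp add: cinner_self)

lemma Re_cinner_commute: "Re (cinner x y) = Re (cinner y x)"
  by (metis cinner_commute complex_cnj(1) complex.sel(1) complex_surj)

lemma power2_norm_add: "(norm (x + y))\<^sup>2 = (norm x)\<^sup>2 + (norm y)\<^sup>2 + 2 * Re (cinner x y)"
  unfolding power2_norm_eq_Re_cinner
  by (simp add: cinner_add_left cinner_add_right Re_cinner_commute[of y x])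

lemma power2_norm_diff: "(norm (x - y))\<^sup>2 = (norm x)\<^sup>2 + (norm y)\<^sup>2 - 2 * Re (cinner x y)"
  unfolding power2_norm_eq_Re_cinner
  by (simp add: cinner_diff_left cinner_diff_right Re_cinner_commute[of y x])

lemma parallelogram_law:
  "(norm (x + y))\<^sup>2 + (norm (x - y))\<^sup>2 = 2 * (norm x)\<^sup>2 + 2 * (norm (y::'a::complex_inner))\<^sup>2"
  by (simp add: power2_norm_add power2_norm_diff)

text \<open>By the parallelogram law applied to \<open>w - x\<close> and \<open>w - y\<close>, two points \<open>x\<close>, \<open>y\<close> of the subspace
  that almost minimise the distance to \<open>w\<close> are close to each other, because their midpoint cannot
  do better than the infimum. A minimising sequence is therefore Cauchy.\<close>

lemma closed_subspace_nearest_point: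
  fixes S :: "'a::chilbert_space set"
  assumes "complex_vector.subspace S" and "closed S"
  obtains p where "p \<in> S" "\<And>x. x \<in> S \<Longrightarrow> (norm (w - p))\<^sup>2 \<le> (norm (w - x))\<^sup>2"
proof -
  let ?g = "\<lambda>x. (norm (w - x))\<^sup>2"
  define D where "D = (INF x\<in>S. ?g x)"
  have ne: "S \<noteq> {}"
    using assms(1) complex_vector.subspace_0 by blast
  have bdd: "bdd_below (?g ` S)"
    by (intro bdd_belowI[of _ 0]) auto
  have D_le: "D \<le> ?g x" if "x \<in> S" for x
    unfolding D_def using bdd that by (rule cINF_lower)
  have "\<exists>x\<in>S. ?g x < D + 1 / real (Suc n)" for n
    unfolding D_def using cINF_less_iff[OF ne bdd, of "D + 1 / real (Suc n)"] by (simp add: D_def)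
  then obtain x where x: "x n \<in> S" "?g (x n) < D + 1 / real (Suc n)" for n
    by metis
  have close: "(norm (x m - x n))\<^sup>2 < 2 / real (Suc m) + 2 / real (Suc n)" for m n
  proof -
    define y where "y = (1/2::real) *\<^sub>R (x m + x n)"
    have "y \<in> S"
      unfolding y_def scaleR_scaleC
      using x(1) assms(1) by (simp add: complex_vector.subspace_add complex_vector.subspace_scale)
    then have "4 * D \<le> 4 * ?g y"
      using D_le by simp
    also have "4 * ?g y = (norm (2 *\<^sub>R (w - y)))\<^sup>2"
      by (simp add: power_mult_distrib)
    also have "2 *\<^sub>R (w - y) = (w - x m) + (w - x n)"
      by (simp add: y_def scaleR_diff_right scaleR_2)
    finally have "4 * D \<le> (norm ((w - x m) + (w - x n)))\<^sup>2" .
    moreover have "norm ((w - x m) - (w - x n)) = norm (x m - x n)"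
      by (simp add: norm_minus_commute)
    ultimately show ?thesis
      using parallelogram_law[of "w - x m" "w - x n"] x(2)[of m] x(2)[of n] by simp
  qed
  have "Cauchy x"
  proof (rule metric_CauchyI)
    fix e :: real
    assume "e > 0"
    then obtain M where M: "1 / real (Suc M) < e\<^sup>2 / 4"
      using nat_approx_posE[of "e\<^sup>2 / 4"] by auto
    have "dist (x m) (x n) < e" if "m \<ge> M" "n \<ge> M" for m n
    proof -
      have "1 / real (Suc k) \<le> 1 / real (Suc M)" if "k \<ge> M" for k
        using that by (intro divide_left_mono) auto
      from this[OF that(1)] this[OF that(2)] close[of m n] M
      have "(norm (x m - x n))\<^sup>2 < e\<^sup>2"
        by simp
      then show ?thesis
        using \<open>e > 0\<close> by (simp add: dist_norm power_less_imp_less_base)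
    qed
    then show "\<exists>M. \<forall>m\<ge>M. \<forall>n\<ge>M. dist (x m) (x n) < e"
      by blast
  qed
  then obtain p where p: "x \<longlonglongrightarrow> p"
    using Cauchy_convergent_iff convergent_def by blast
  have "?g p \<le> D"
  proof (rule LIMSEQ_le)
    show "(\<lambda>n. ?g (x n)) \<longlonglongrightarrow> ?g p"
      by (intro tendsto_intros p)
    show "(\<lambda>n. D + 1 / real (Suc n)) \<longlonglongrightarrow> D"
      using tendsto_add[OF tendsto_const[of D] LIMSEQ_inverse_real_of_nat]
      by (simp add: inverse_eq_divide)
    show "\<exists>N. \<forall>n\<ge>N. ?g (x n) \<le> D + 1 / real (Suc n)"
      using x(2) less_imp_le by blast
  qed
  moreover have "p \<in> S"
    using assms(2) x(1) p by (rule closed_sequentially)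
  ultimately show ?thesis
    using that D_le order_trans by blast
qed

lemma orthogonal_if_nearest:
  assumes min: "\<And>c. (norm z)\<^sup>2 \<le> (norm (z - c *\<^sub>C s))\<^sup>2"
  shows "cinner z s = 0"
proof (rule ccontr)
  assume nz: "cinner z s \<noteq> 0"
  then have s: "norm s > 0"
    by auto
  \<comment> \<open>the coefficient of the orthogonal projection of \<open>z\<close> onto the line through \<open>s\<close>\<close>
  define c where "c = cinner z s / complex_of_real ((norm s)\<^sup>2)"
  have abs_sq: "cinner z s * cnj (cinner z s) = (complex_of_real (cmod (cinner z s)))\<^sup>2"
    by (metis complex_norm_square of_real_power)
  have "cinner z (c *\<^sub>C s) = complex_of_real ((cmod (cinner z s))\<^sup>2 / (norm s)\<^sup>2)"
    unfolding c_def cinner_scaleC_right by (simp add: abs_sq mult.commute)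
  moreover have "cinner (c *\<^sub>C s) (c *\<^sub>C s)
      = complex_of_real ((cmod (cinner z s))\<^sup>2 / (norm s)\<^sup>2)"
    unfolding cinner_scaleC_left cinner_scaleC_right cinner_self[of s] c_def using s
    by (simp add: abs_sq field_simps)
  ultimately have "(norm (z - c *\<^sub>C s))\<^sup>2 = (norm z)\<^sup>2 - (cmod (cinner z s))\<^sup>2 / (norm s)\<^sup>2"
    using power2_norm_diff[of z "c *\<^sub>C s"] power2_norm_eq_Re_cinner[of "c *\<^sub>C s"]
    by (simp del: of_real_divide of_real_power)
  moreover have "(cmod (cinner z s))\<^sup>2 / (norm s)\<^sup>2 > 0"
    using nz s by simp
  ultimately show False
    using min[of c] by simp
qed

text \<open>For the point \<open>p\<close> of \<open>S\<close> nearest to \<open>w\<close>, the difference \<open>w - p\<close> is orthogonal to \<open>S\<close>, hence to \<open>p\<close>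
  and by assumption to \<open>w\<close>, and so to itself.\<close>

lemma double_orthogonal_complement:
  fixes S :: "'a::chilbert_space set"
  assumes S: "complex_vector.subspace S" and "closed S"
    and orth: "\<And>z. (\<And>s. s \<in> S \<Longrightarrow> cinner s z = 0) \<Longrightarrow> cinner w z = 0"
  shows "w \<in> S"
proof -
  obtain p where p: "p \<in> S" and min: "\<And>x. x \<in> S \<Longrightarrow> (norm (w - p))\<^sup>2 \<le> (norm (w - x))\<^sup>2"
    using closed_subspace_nearest_point[OF assms(1,2)] by blast
  have perp: "cinner s (w - p) = 0" if "s \<in> S" for s
  proof -
    have "cinner (w - p) s = 0"
    proof (rule orthogonal_if_nearest)
      fix c
      have "p + c *\<^sub>C s \<in> S"
        using S p that by (simp add: complex_vector.subspace_add complex_vector.subspace_scale)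
      from min[OF this] show "(norm (w - p))\<^sup>2 \<le> (norm (w - p - c *\<^sub>C s))\<^sup>2"
        by (simp add: diff_diff_eq)
    qed
    then show ?thesis
      by (metis cinner_commute complex_cnj_zero)
  qed
  have "cinner (w - p) (w - p) = 0"
    using orth[OF perp] perp[OF p] by (simp add: cinner_diff_left)
  then have "w = p"
    by (simp add: cinner_self)
  with p show ?thesis
    by simp
qed

section \<open>Adjoints\<close>

lemma op_app_eq: "B u = Some w \<Longrightarrow> B \<cdot> u = w"
  by (simp add: op_app_def)

lemma op_adjoint_cinner:
  assumes "densely_defined B" and "v \<in> dom (op_adjoint B)" and "u \<in> dom B"
  shows "cinner (B \<cdot> u) v = cinner u (op_adjoint B \<cdot> v)"
proof -
  obtain w where "op_adjoint B v = Some w"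
    using assms(2) by blast
  then show ?thesis
    using assms(3) op_adjoint_eq_Some[OF assms(1)] by (simp add: op_app_eq[of _ _ w])
qed

lemma symmetric_op_adjoint:
  assumes "densely_defined A" and "symmetric_op A" and "u \<in> dom A"
  shows "op_adjoint A u = Some (A \<cdot> u)"
  using assms by (simp add: op_adjoint_eq_Some symmetric_op_def)

lemma subspace_graph:
  assumes "linear_op B"
  shows "complex_vector.subspace (Map.graph B)"
proof -
  have sub: "complex_vector.subspace (dom B)" and lin: "clinear_on (dom B) (op_app B)"
    using assms by (auto simp: linear_op_def)
  have graph: "Map.graph B = (\<lambda>u. (u, B \<cdot> u)) ` dom B"
    by (force simp: Map.graph_def op_app_def)
  have add: "(u + v, B \<cdot> u + B \<cdot> v) \<in> Map.graph B" if "u \<in> dom B" "v \<in> dom B" for u v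
    unfolding graph
    using that sub lin by (intro image_eqI[of _ _ "u + v"])
      (auto simp: clinear_on_def complex_vector.subspace_add)
  have scale: "(c *\<^sub>C u, c *\<^sub>C (B \<cdot> u)) \<in> Map.graph B" if "u \<in> dom B" for u c
    unfolding graph
    using that sub lin by (intro image_eqI[of _ _ "c *\<^sub>C u"])
      (auto simp: clinear_on_def complex_vector.subspace_scale)
  have "0 \<in> dom B"
    using sub by (rule complex_vector.subspace_0)
  from scale[OF this, of 0] have "0 \<in> Map.graph B"
    by (simp add: zero_prod_def)
  moreover have "x + y \<in> Map.graph B" if "x \<in> Map.graph B" "y \<in> Map.graph B" for x y
  proof -
    from that obtain u v where "u \<in> dom B" "v \<in> dom B" "x = (u, B \<cdot> u)" "y = (v, B \<cdot> v)"
      unfolding graph by blast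
    with add[of u v] show ?thesis
      by simp
  qed
  moreover have "c *\<^sub>C x \<in> Map.graph B" if "x \<in> Map.graph B" for x c
  proof -
    from that obtain u where "u \<in> dom B" "x = (u, B \<cdot> u)"
      unfolding graph by blast
    with scale[of u c] show ?thesis
      by (simp add: scaleC_prod_def)
  qed
  ultimately show ?thesis
    unfolding complex_vector.subspace_def by blast
qed

text \<open>The inclusion \<open>A\<^sup>*\<^sup>* \<subseteq> A\<close>, spelled out on elements: a vector \<open>(z\<^sub>1, z\<^sub>2)\<close> is orthogonal to the
  graph of \<open>A\<close> if and only if \<open>A\<^sup>* z\<^sub>2 = - z\<^sub>1\<close>, and the hypothesis says exactly that \<open>(u, w)\<close> is
  orthogonal to all of these vectors.\<close>

lemma closed_op_biadjoint:
  fixes A :: "'h::chilbert_space \<rightharpoonup> 'k::chilbert_space"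
  assumes "linear_op A" and "closed_op A" and dense: "densely_defined A"
    and eq: "\<And>v. v \<in> dom (op_adjoint A) \<Longrightarrow> cinner w v = cinner u (op_adjoint A \<cdot> v)"
  shows "A u = Some w"
proof -
  have "(u, w) \<in> Map.graph A"
  proof (rule double_orthogonal_complement)
    show "complex_vector.subspace (Map.graph A)"
      using assms(1) by (rule subspace_graph)
    show "closed (Map.graph A)"
      using assms(2) by (simp add: closed_op_def)
  next
    fix z :: "'h \<times> 'k"
    assume z: "\<And>s. s \<in> Map.graph A \<Longrightarrow> cinner s z = 0"
    have "cinner (A \<cdot> x) (snd z) = cinner x (- fst z)" if "x \<in> dom A" for x
    proof -
      have "(x, A \<cdot> x) \<in> Map.graph A"
        using that by (auto simp: Map.graph_def op_app_def)
      from z[OF this] have "cinner (A \<cdot> x) (snd z) + cinner x (fst z) = 0"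
        by (simp add: cinner_prod_def add.commute)
      then show ?thesis
        by (simp add: cinner_minus_right eq_neg_iff_add_eq_0)
    qed
    then have "op_adjoint A (snd z) = Some (- fst z)"
      by (simp add: op_adjoint_eq_Some[OF dense])
    then have "cinner w (snd z) = - cinner u (fst z)"
      using eq[of "snd z"] by (simp add: domI op_app_eq cinner_minus_right)
    then show "cinner (u, w) z = 0"
      by (simp add: cinner_prod_def)
  qed
  then show ?thesis
    by (simp add: Map.graph_def)
qed

text \<open>The flip is its own adjoint and everywhere defined, so it can be moved across the scalar
  product in the defining equation of the adjoint, for any operator \<open>B\<close> into the product.\<close>

lemma op_adjoint_tau_comp:
  fixes B :: "'a::complex_inner \<rightharpoonup> 'h::complex_inner \<times> 'h"
  shows "op_adjoint (\<tau> \<circ>\<^sub>m B) = op_adjoint B \<circ>\<^sub>m \<tau>"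
proof
  fix v :: "'h \<times> 'h"
  obtain v1 v2 where v: "v = (v1, v2)"
    by (cases v)
  have dom: "dom (\<tau> \<circ>\<^sub>m B) = dom B"
    by (auto simp: map_comp_def \<tau>_def split: option.splits)
  have "cinner ((\<tau> \<circ>\<^sub>m B) \<cdot> u) (v1, v2) = cinner (B \<cdot> u) (v2, v1)" if "u \<in> dom B" for u
    using that by (auto simp: op_app_def \<tau>_def cinner_prod_def add.commute)
  then have "(\<forall>u\<in>dom (\<tau> \<circ>\<^sub>m B). cinner ((\<tau> \<circ>\<^sub>m B) \<cdot> u) (v1, v2) = cinner u w)
      \<longleftrightarrow> (\<forall>u\<in>dom B. cinner (B \<cdot> u) (v2, v1) = cinner u w)" for w
    unfolding dom by simp
  then have "op_adjoint (\<tau> \<circ>\<^sub>m B) (v1, v2) = op_adjoint B (v2, v1)"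
    unfolding op_adjoint_def by simp
  then show "op_adjoint (\<tau> \<circ>\<^sub>m B) v = (op_adjoint B \<circ>\<^sub>m \<tau>) v"
    by (simp add: v \<tau>_def)
qed

lemma op_shift_zero: "op_shift B 0 = B"
  by (simp add: op_shift_def fun_eq_iff option.map_ident)

lemma shift_adjoint_tau_app:
  assumes "linear_op A" and "densely_defined A" and "u1 \<in> Hplus A" and "u2 \<in> Hplus A"
  shows "(op_shift (op_adjoint (N_op A)) z \<circ>\<^sub>m \<tau>) \<cdot> (u1, u2)
    = (op_adjoint A \<cdot> u1 + z *\<^sub>C u2, - (op_adjoint A \<cdot> u2) + z *\<^sub>C u1)"
  using assms(3,4)
  by (simp add: op_app_def[of "_ \<circ>\<^sub>m _"] op_adjoint_N_op[OF assms(1,2)] op_shift_def \<tau>_def Hplus_def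
      scaleC_prod_def)

section \<open>The trace operator and its double\<close>

text \<open>The element \<open>v\<close> supplied by surjectivity has traces \<open>(\<Gamma>\<^sub>1 u, - \<Gamma>\<^sub>0 u)\<close>, for which the boundary
  form equals \<open>\<parallel>\<Gamma>\<^sub>1 u\<parallel>\<^sup>2 + \<parallel>\<Gamma>\<^sub>0 u\<parallel>\<^sup>2\<close>.\<close>

lemma trace_eq_0_if_dom:
  fixes A :: "'h::complex_inner \<rightharpoonup> 'h" and \<Gamma>0 \<Gamma>1 :: "'h \<Rightarrow> 'k::complex_inner"
  assumes "densely_defined A" and "symmetric_op A"
    and surj: "tr \<Gamma>0 \<Gamma>1 ` Hplus A = UNIV"
    and Green: "\<And>u v. u \<in> dom (op_adjoint A) \<Longrightarrow> v \<in> dom (op_adjoint A) \<Longrightarrow>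
      cinner (op_adjoint A \<cdot> u) v - cinner u (op_adjoint A \<cdot> v)
        = cinner (\<Gamma>1 u) (\<Gamma>0 v) - cinner (\<Gamma>0 u) (\<Gamma>1 v)"
    and u: "u \<in> dom A"
  shows "tr \<Gamma>0 \<Gamma>1 u = 0"
proof -
  have adj: "op_adjoint A u = Some (A \<cdot> u)"
    using assms(1,2) u by (rule symmetric_op_adjoint)
  then have u_adj: "u \<in> dom (op_adjoint A)"
    by blast
  have "(\<Gamma>1 u, - \<Gamma>0 u) \<in> tr \<Gamma>0 \<Gamma>1 ` Hplus A"
    by (simp add: surj)
  then obtain v where "(\<Gamma>1 u, - \<Gamma>0 u) = tr \<Gamma>0 \<Gamma>1 v" and "v \<in> Hplus A"
    by (rule imageE)
  then have v: "v \<in> dom (op_adjoint A)" "\<Gamma>0 v = \<Gamma>1 u" "\<Gamma>1 v = - \<Gamma>0 u"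
    by (simp_all add: tr_def Hplus_def)
  have "cinner (\<Gamma>1 u) (\<Gamma>1 u) + cinner (\<Gamma>0 u) (\<Gamma>0 u)
      = cinner (op_adjoint A \<cdot> u) v - cinner u (op_adjoint A \<cdot> v)"
    using Green[OF u_adj v(1)] v(2,3) by (simp add: cinner_minus_right)
  also have "\<dots> = 0"
    using op_adjoint_cinner[OF assms(1) v(1) u] by (simp add: op_app_eq[of "op_adjoint A", OF adj])
  finally have "Re (cinner (\<Gamma>1 u) (\<Gamma>1 u) + cinner (\<Gamma>0 u) (\<Gamma>0 u)) = 0"
    by simp
  then have "(norm (\<Gamma>1 u))\<^sup>2 + (norm (\<Gamma>0 u))\<^sup>2 = 0"
    by (simp add: power2_norm_eq_Re_cinner)
  then show ?thesis
    by (simp add: tr_def zero_prod_def sum_power2_eq_zero_iff)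
qed

lemma trace_kernel_eq_dom:
  fixes A :: "'h::chilbert_space \<rightharpoonup> 'h" and \<Gamma>0 \<Gamma>1 :: "'h \<Rightarrow> 'k::complex_inner"
  assumes "linear_op A" and "closed_op A" and "densely_defined A" and "symmetric_op A"
    and surj: "tr \<Gamma>0 \<Gamma>1 ` Hplus A = UNIV"
    and Green: "\<And>u v. u \<in> dom (op_adjoint A) \<Longrightarrow> v \<in> dom (op_adjoint A) \<Longrightarrow>
      cinner (op_adjoint A \<cdot> u) v - cinner u (op_adjoint A \<cdot> v)
        = cinner (\<Gamma>1 u) (\<Gamma>0 v) - cinner (\<Gamma>0 u) (\<Gamma>1 v)"
  shows "{u \<in> Hplus A. tr \<Gamma>0 \<Gamma>1 u = 0} = dom A"
proof (intro equalityI subsetI)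
  fix u
  assume "u \<in> {u \<in> Hplus A. tr \<Gamma>0 \<Gamma>1 u = 0}"
  then have u: "u \<in> dom (op_adjoint A)" "\<Gamma>0 u = 0" "\<Gamma>1 u = 0"
    by (auto simp: Hplus_def tr_def zero_prod_def)
  have "A u = Some (op_adjoint A \<cdot> u)"
    using Green[OF u(1)] u(2,3) by (intro closed_op_biadjoint assms(1-3)) simp
  then show "u \<in> dom A"
    by (rule domI)
next
  fix u
  assume "u \<in> dom A"
  then show "u \<in> {u \<in> Hplus A. tr \<Gamma>0 \<Gamma>1 u = 0}"
    using trace_eq_0_if_dom[OF assms(3,4) surj Green]
      symmetric_op_adjoint[OF assms(3,4)] by (auto simp: Hplus_def)
qed

lemma bounded_wrt_Tr:
  assumes "bounded_wrt (Hplus_inner A) (Hplus A) (tr \<Gamma>0 \<Gamma>1)"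
  shows "bounded_wrt (Hplus2_inner A) (Hplus2 A) (Tr \<Gamma>0 \<Gamma>1)"
proof -
  obtain C where C: "\<And>u. u \<in> Hplus A \<Longrightarrow>
      norm (tr \<Gamma>0 \<Gamma>1 u) \<le> C * sqrt (Re (Hplus_inner A u u))"
    using assms unfolding bounded_wrt_def by blast
  have pos: "Re (Hplus_inner A u u) \<ge> 0" for u
    by (simp add: Hplus_inner_def flip: power2_norm_eq_Re_cinner)
  have sq: "(norm (tr \<Gamma>0 \<Gamma>1 u))\<^sup>2 \<le> C\<^sup>2 * Re (Hplus_inner A u u)" if "u \<in> Hplus A" for u
    using power_mono[OF C[OF that], of 2] pos[of u] by (simp add: power_mult_distrib)
  \<comment> \<open>a bound \<open>C\<close> that holds on a trivial space may be negative\<close>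
  have "norm (Tr \<Gamma>0 \<Gamma>1 u) \<le> \<bar>C\<bar> * sqrt (Re (Hplus2_inner A u u))" if "u \<in> Hplus2 A" for u
  proof -
    have u: "fst u \<in> Hplus A" "snd u \<in> Hplus A"
      using that by (auto simp: Hplus2_def)
    have "norm (Tr \<Gamma>0 \<Gamma>1 u)
        = sqrt ((norm (tr \<Gamma>0 \<Gamma>1 (fst u)))\<^sup>2 + (norm (tr \<Gamma>0 \<Gamma>1 (snd u)))\<^sup>2)"
      by (simp add: Tr_def norm_prod_def)
    also have "\<dots> \<le> sqrt (C\<^sup>2 * Re (Hplus2_inner A u u))"
      using sq[OF u(1)] sq[OF u(2)] by (simp add: Hplus2_inner_def distrib_left)
    also have "\<dots> = \<bar>C\<bar> * sqrt (Re (Hplus2_inner A u u))"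
      by (simp add: real_sqrt_mult)
    finally show ?thesis .
  qed
  then show ?thesis
    unfolding bounded_wrt_def by blast
qed

lemma clinear_on_Tr:
  assumes "clinear_on (Hplus A) (tr \<Gamma>0 \<Gamma>1)"
  shows "clinear_on (Hplus2 A) (Tr \<Gamma>0 \<Gamma>1)"
  using assms by (auto simp: clinear_on_def Hplus2_def Tr_def scaleC_prod_def)

lemma Green_shift_adjoint_tau:
  fixes A :: "'h::complex_inner \<rightharpoonup> 'h" and \<Gamma>0 \<Gamma>1 :: "'h \<Rightarrow> 'k::complex_inner"
  assumes "linear_op A" and "densely_defined A"
    and Green: "\<And>u v. u \<in> dom (op_adjoint A) \<Longrightarrow> v \<in> dom (op_adjoint A) \<Longrightarrow>
      cinner (op_adjoint A \<cdot> u) v - cinner u (op_adjoint A \<cdot> v)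
        = cinner (\<Gamma>1 u) (\<Gamma>0 v) - cinner (\<Gamma>0 u) (\<Gamma>1 v)"
    and "u \<in> Hplus2 A" and "v \<in> Hplus2 A"
  shows "cinner ((op_shift (op_adjoint (N_op A)) (complex_of_real r) \<circ>\<^sub>m \<tau>) \<cdot> u) v
      - cinner u ((op_shift (op_adjoint (N_op A)) (complex_of_real r) \<circ>\<^sub>m \<tau>) \<cdot> v)
    = \<Omega> (Tr \<Gamma>0 \<Gamma>1 u) (Tr \<Gamma>0 \<Gamma>1 v)"
proof -
  obtain u1 u2 v1 v2 where uv: "u = (u1, u2)" "v = (v1, v2)"
    by (cases u, cases v)
  have mem: "u1 \<in> Hplus A" "u2 \<in> Hplus A" "v1 \<in> Hplus A" "v2 \<in> Hplus A"
    using assms(4,5) by (auto simp: Hplus2_def uv)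
  have "cinner ((op_shift (op_adjoint (N_op A)) (complex_of_real r) \<circ>\<^sub>m \<tau>) \<cdot> u) v
      - cinner u ((op_shift (op_adjoint (N_op A)) (complex_of_real r) \<circ>\<^sub>m \<tau>) \<cdot> v)
    = (cinner (op_adjoint A \<cdot> u1) v1 - cinner u1 (op_adjoint A \<cdot> v1))
      - (cinner (op_adjoint A \<cdot> u2) v2 - cinner u2 (op_adjoint A \<cdot> v2))"
    unfolding uv
    by (simp add: shift_adjoint_tau_app[OF assms(1,2)] mem cinner_prod_def cinner_add_left
        cinner_add_right cinner_diff_left cinner_diff_right cinner_minus_left cinner_minus_right
        cinner_scaleC_left cinner_scaleC_right)
  also have "\<dots> = \<Omega> (Tr \<Gamma>0 \<Gamma>1 u) (Tr \<Gamma>0 \<Gamma>1 v)"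
    using mem by (simp add: Green Hplus_def uv Tr_apply)
  finally show ?thesis .
qed

theorem proposition2p2:
  fixes A :: "'h::chilbert_space \<rightharpoonup> 'h"
    and \<Gamma>0 \<Gamma>1 :: "'h \<Rightarrow> 'k::chilbert_space"
  assumes separable_h: "\<exists>D :: 'h set. countable D \<and> closure D = UNIV"
    and separable_k: "\<exists>D :: 'k set. countable D \<and> closure D = UNIV"
    and linear_A: "linear_op A"
    and closed_A: "closed_op A"
    and dense_A: "densely_defined A"
    and symmetric_A: "symmetric_op A"
    and deficiency_finite:
      "finite_cdim (op_ker (op_shift (op_adjoint A) \<i>))"
      "finite_cdim (op_ker (op_shift (op_adjoint A) (- \<i>)))"
    and deficiency_eq:
      "complex_vector.dim (op_ker (op_shift (op_adjoint A) \<i>))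
        = complex_vector.dim (op_ker (op_shift (op_adjoint A) (- \<i>)))"
    and linear_tr: "clinear_on (Hplus A) (tr \<Gamma>0 \<Gamma>1)"
    and bounded_tr: "bounded_wrt (Hplus_inner A) (Hplus A) (tr \<Gamma>0 \<Gamma>1)"
    and surj_tr: "tr \<Gamma>0 \<Gamma>1 ` Hplus A = UNIV"
    and Green: "\<And>u v. u \<in> dom (op_adjoint A) \<Longrightarrow> v \<in> dom (op_adjoint A) \<Longrightarrow>
      cinner (op_adjoint A \<cdot> u) v - cinner u (op_adjoint A \<cdot> v)
        = cinner (\<Gamma>1 u) (\<Gamma>0 v) - cinner (\<Gamma>0 u) (\<Gamma>1 v)"
  shows "clinear_on (Hplus2 A) (Tr \<Gamma>0 \<Gamma>1)
    \<and> bounded_wrt (Hplus2_inner A) (Hplus2 A) (Tr \<Gamma>0 \<Gamma>1)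
    \<and> Tr \<Gamma>0 \<Gamma>1 ` Hplus2 A = UNIV
    \<and> {u \<in> Hplus2 A. Tr \<Gamma>0 \<Gamma>1 u = 0} = dom (N_op A)
    \<and> dom (N_op A) = dom A \<times> dom A
    \<and> dom (op_adjoint (\<tau> \<circ>\<^sub>m N_op A)) = Hplus2 A
    \<and> (\<forall>u\<in>dom (op_adjoint (\<tau> \<circ>\<^sub>m N_op A)). \<forall>v\<in>dom (op_adjoint (\<tau> \<circ>\<^sub>m N_op A)).
        cinner (op_adjoint (\<tau> \<circ>\<^sub>m N_op A) \<cdot> u) v - cinner u (op_adjoint (\<tau> \<circ>\<^sub>m N_op A) \<cdot> v)
          = \<Omega> (Tr \<Gamma>0 \<Gamma>1 u) (Tr \<Gamma>0 \<Gamma>1 v))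
    \<and> (\<forall>l::real. \<forall>u\<in>Hplus2 A. \<forall>v\<in>Hplus2 A.
        cinner ((op_shift (op_adjoint (N_op A)) (- complex_of_real l) \<circ>\<^sub>m \<tau>) \<cdot> u) v
          - cinner u ((op_shift (op_adjoint (N_op A)) (- complex_of_real l) \<circ>\<^sub>m \<tau>) \<cdot> v)
          = \<Omega> (Tr \<Gamma>0 \<Gamma>1 u) (Tr \<Gamma>0 \<Gamma>1 v))"
proof -
  have dom_N: "dom (N_op A) = dom A \<times> dom A"
    by (auto simp: N_op_def split: if_splits)
  have "Tr \<Gamma>0 \<Gamma>1 ` Hplus2 A = UNIV"
    by (simp add: Tr_def Hplus2_def map_prod_image surj_tr map_prod_surj_on[of _ _ UNIV _ _ UNIV])
  moreover have "{u \<in> Hplus2 A. Tr \<Gamma>0 \<Gamma>1 u = 0} = dom (N_op A)"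
  proof -
    have "{u \<in> Hplus2 A. Tr \<Gamma>0 \<Gamma>1 u = 0}
        = {u \<in> Hplus A. tr \<Gamma>0 \<Gamma>1 u = 0} \<times> {u \<in> Hplus A. tr \<Gamma>0 \<Gamma>1 u = 0}"
      by (auto simp: Hplus2_def Tr_def zero_prod_def)
    then show ?thesis
      using trace_kernel_eq_dom[OF linear_A closed_A dense_A symmetric_A surj_tr Green]
      by (simp only: dom_N)
  qed
  \<comment> \<open>\<open>(\<tau> N)\<^sup>*\<close> as a shifted operator, with zero shift\<close>
  moreover have adj: "op_adjoint (\<tau> \<circ>\<^sub>m N_op A)
      = op_shift (op_adjoint (N_op A)) (complex_of_real 0) \<circ>\<^sub>m \<tau>"
    by (simp add: op_adjoint_tau_comp op_shift_zero)
  moreover have dom_adj: "dom (op_adjoint (\<tau> \<circ>\<^sub>m N_op A)) = Hplus2 A"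
    unfolding adj by (rule dom_shift_adjoint_tau[OF linear_A dense_A])
  moreover have "cinner (op_adjoint (\<tau> \<circ>\<^sub>m N_op A) \<cdot> u) v
      - cinner u (op_adjoint (\<tau> \<circ>\<^sub>m N_op A) \<cdot> v) = \<Omega> (Tr \<Gamma>0 \<Gamma>1 u) (Tr \<Gamma>0 \<Gamma>1 v)"
    if "u \<in> Hplus2 A" "v \<in> Hplus2 A" for u v
    unfolding adj using that by (intro Green_shift_adjoint_tau linear_A dense_A Green)
  moreover have "cinner ((op_shift (op_adjoint (N_op A)) (- complex_of_real l) \<circ>\<^sub>m \<tau>) \<cdot> u) v
      - cinner u ((op_shift (op_adjoint (N_op A)) (- complex_of_real l) \<circ>\<^sub>m \<tau>) \<cdot> v)
      = \<Omega> (Tr \<Gamma>0 \<Gamma>1 u) (Tr \<Gamma>0 \<Gamma>1 v)"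
    if "u \<in> Hplus2 A" "v \<in> Hplus2 A" for u v and l :: real
    using Green_shift_adjoint_tau[OF linear_A dense_A Green that, of "- l"] by simp
  ultimately show ?thesis
    using clinear_on_Tr[OF linear_tr] bounded_wrt_Tr[OF bounded_tr] dom_N unfolding dom_adj by blast
qed

end
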